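(* Let $\epsilon>0$, $p\in(0,1)$, $q_1,\ldots,q_4\in(0,1)$ with $\sum_{j=1}^4q_j=1$, $0<\eta\le1/2$, and $(\alpha,\beta)\in\{(-1,-1),(-1,0),(0,-1),(0,0)\}$. Consider the randomized algorithm which, given a database $D=\{(X_i,Z_i,Y_i)\}_{i=1}^n$ with $\|X_i\|_2\le1$, $Z_i\in\{0,1\}$, $Y_i\in[0,1]$, does the following. First stage: (i) draw $\tilde\theta$ exactly from the density on $\Theta\subset\mathbb R^d$ proportional to $\exp\{-\frac{p\epsilon}{2\Delta_{\theta,\alpha,\beta}}\|\nabla_\theta S_{n,\alpha,\beta}(\theta;D)\|_2\}$; (ii) compute $e_{\tilde\theta}(X_i)$ and truncate it to $[\eta,1-\eta]$. Second stage: compute the weights $\tilde w(X_i,z)$ from the truncated $e_{\tilde\theta}(X_i)$ and output $$\tilde\tau^{(2)}_{\alpha,\beta}=\frac{\sum_{i=1}^nZ_i\tilde w(X_i,1)Y_i+\nu_1}{\sum_{i=1}^nZ_i\tilde w(X_i,1)+\nu_2}-\frac{\sum_{i=1}^n(1-Z_i)\tilde w(X_i,0)Y_i+\nu_3}{\sum_{i=1}^n(1-Z_i)\tilde w(X_i,0)+\nu_4},$$ where $\nu_1,\ldots,\nu_4$ are independent Laplace variables (independent of everything else), $\nu_j$ having mean $0$ and scale $\frac{1}{(1-p)q_j\epsilon\eta}$. Then this algorithm satisfies $\epsilon$-differential privacy.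
   Context: $\epsilon$-differential privacy: a randomized algorithm $\mathcal M$ satisfies it if for all databases $D,D'$ with $n$ records differing in exactly one record (Hamming distance $1$) and all measurable sets $B$, $\Pr\{\mathcal M(D)\in B\}\le e^{\epsilon}\Pr\{\mathcal M(D')\in B\}$. Model: $e_\theta(x)=\exp\{\theta^\top\phi(x)\}/[1+\exp\{\theta^\top\phi(x)\}]$, $\theta\in\Theta$ (a convex subset of $\mathbb R^d$), with $\phi=(\phi_1,\ldots,\phi_d)^\top$ and $\|\phi(x)\|_2\le C_\phi<\infty$. Gradient of the Beta-family score: $\nabla_\theta S_{n,\alpha,\beta}(\theta;D)=\sum_{i=1}^n\{Z_i-e_\theta(X_i)\}e_\theta(X_i)^\alpha\{1-e_\theta(X_i)\}^\beta\phi(X_i)$. $\Delta_{\theta,\alpha,\beta}\in(0,\infty)$ is the sensitivity of this gradient: $\|\nabla_\theta S_{n,\alpha,\beta}(\theta;D)-\nabla_\theta S_{n,\alpha,\beta}(\theta;D')\|_2\le\Delta_{\theta,\alpha,\beta}$ for all $\theta\in\Theta$ and all $D,D'$ differing in exactly one record. (Under the positivity bound $\eta\le e_\theta(x)\le1-\eta$ it is taken to be $2C_\phi/\eta$ for $(-1,-1)$, $2C_\phi(1-\eta)/\eta$ for $(-1,0)$ and $(0,-1)$, and $2C_\phi(1-\eta)$ for $(0,0)$.) As required for the K-norm gradient mechanism, $\int_\Theta\exp\{-\frac{1}{\Delta_{\theta,\alpha,\beta}}\|\nabla_\theta S_{n,\alpha,\beta}(\theta;D)\|_2\}d\theta<\infty$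 for every $D$, and the sampling density is assumed to be well defined (normalizable). Weights: $\tilde w(x,z)=e^\alpha(1-e)^\beta\{z(1-e)+(1-z)e\}$ evaluated at $e$ equal to $e_{\tilde\theta}(x)$ truncated to $[\eta,1-\eta]$. *)

theory Defs
  imports "HOL-Probability.Probability"
begin

definition databases :: "'r set \<Rightarrow> nat \<Rightarrow> 'r list set" where
  "databases R n = {D. length D = n \<and> set D \<subseteq> R}"

definition hamming :: "'r list \<Rightarrow> 'r list \<Rightarrow> nat" where
  "hamming D D' = card {i. i < length D \<and> D ! i \<noteq> D' ! i}"

definition adjacent :: "'r set \<Rightarrow> nat \<Rightarrow> 'r list \<Rightarrow> 'r list \<Rightarrow> bool" where
  "adjacent R n D D' \<longleftrightarrow> D \<in> databases R n \<and> D' \<in> databases R n \<and> hamming D D' = 1"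

text \<open>
  A randomized algorithm is given by the distribution of its output on each database.  The first
  conjunct says that every output distribution is a probability measure on the measurable space
  \<open>N\<close>, so that the inequality cannot hold merely because some output law is degenerate.
\<close>

definition differentially_private ::
  "'r set \<Rightarrow> nat \<Rightarrow> 'o measure \<Rightarrow> real \<Rightarrow> ('r list \<Rightarrow> 'o measure) \<Rightarrow> bool" where
  "differentially_private R n N \<epsilon> M \<longleftrightarrow>
     (\<forall>D\<in>databases R n. M D \<in> space (prob_algebra N)) \<and>
     (\<forall>D D'. adjacent R n D D' \<longrightarrow>
        (\<forall>B\<in>sets N. measure (M D) B \<le> exp \<epsilon> * measure (M D') B))"

definition laplace :: "real \<Rightarrow> real \<Rightarrow> real measure" where
  "laplace m b = density lborel (\<lambda>t. ennreal (exp (- \<bar>t - m\<bar> / b) / (2 * b)))"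

text \<open>
  The law on \<open>\<Theta>\<close> with Lebesgue density proportional to \<open>g\<close>.  Lebesgue rather than Borel
  measurability is used because a convex set is Lebesgue measurable but need not be Borel.
\<close>

definition proportional_to :: "'a::euclidean_space set \<Rightarrow> ('a \<Rightarrow> real) \<Rightarrow> 'a measure" where
  "proportional_to \<Theta> g =
     density (lebesgue_on \<Theta>) (\<lambda>\<theta>. ennreal (g \<theta> / (\<integral>t. g t \<partial>lebesgue_on \<Theta>)))"

definition normalizable :: "'a::euclidean_space set \<Rightarrow> ('a \<Rightarrow> real) \<Rightarrow> bool" where
  "normalizable \<Theta> g \<longleftrightarrow>
     integrable (lebesgue_on \<Theta>) g \<and> 0 < (\<integral>t. g t \<partial>lebesgue_on \<Theta>)"

text \<open>The components are covariates, treatment indicator and outcome.\<close>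

type_synonym 'k obs = "(real ^ 'k) \<times> real \<times> real"

definition records :: "'k::finite obs set" where
  "records = {(x, z, y). norm x \<le> 1 \<and> z \<in> {0, 1} \<and> 0 \<le> y \<and> y \<le> 1}"

definition propensity ::
  "(real ^ 'k::finite \<Rightarrow> real ^ 'd::finite) \<Rightarrow> real ^ 'd \<Rightarrow> real ^ 'k \<Rightarrow> real" where
  "propensity \<phi> \<theta> x = exp (\<theta> \<bullet> \<phi> x) / (1 + exp (\<theta> \<bullet> \<phi> x))"

definition grad_score ::
  "(real ^ 'k::finite \<Rightarrow> real ^ 'd::finite) \<Rightarrow> real \<Rightarrow> real \<Rightarrow> real ^ 'd \<Rightarrow> 'k obs list \<Rightarrow> real ^ 'd"
where
  "grad_score \<phi> \<alpha> \<beta> \<theta> D =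
     (\<Sum>(x, z, y)\<leftarrow>D. ((z - propensity \<phi> \<theta> x) * propensity \<phi> \<theta> x powr \<alpha>
                        * (1 - propensity \<phi> \<theta> x) powr \<beta>) *\<^sub>R \<phi> x)"

definition trunc :: "real \<Rightarrow> real \<Rightarrow> real" where
  "trunc \<eta> e = max \<eta> (min (1 - \<eta>) e)"

definition weight :: "real \<Rightarrow> real \<Rightarrow> real \<Rightarrow> real \<Rightarrow> real" where
  "weight \<alpha> \<beta> e z = e powr \<alpha> * (1 - e) powr \<beta> * (z * (1 - e) + (1 - z) * e)"

definition trunc_weight ::
  "(real ^ 'k::finite \<Rightarrow> real ^ 'd::finite) \<Rightarrow> real \<Rightarrow> real \<Rightarrow> real \<Rightarrow> real ^ 'd \<Rightarrow> real ^ 'k \<Rightarrow> real \<Rightarrow> real"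
where
  "trunc_weight \<phi> \<alpha> \<beta> \<eta> \<theta> x z = weight \<alpha> \<beta> (trunc \<eta> (propensity \<phi> \<theta> x)) z"

text \<open>
  The first-stage density up to normalization for privacy budget \<open>b\<close>; the factor 2 absorbs the
  change of the normalizing constant between adjacent databases.
\<close>

definition kng_weight ::
  "(real ^ 'k::finite \<Rightarrow> real ^ 'd::finite) \<Rightarrow> real \<Rightarrow> real \<Rightarrow> (real ^ 'd \<Rightarrow> real) \<Rightarrow> real
     \<Rightarrow> 'k obs list \<Rightarrow> real ^ 'd \<Rightarrow> real"
where
  "kng_weight \<phi> \<alpha> \<beta> \<Delta> b D \<theta> = exp (- (b / (2 * \<Delta> \<theta>)) * norm (grad_score \<phi> \<alpha> \<beta> \<theta> D))"

text \<open>The denominators vanish only on a null set of noise values, where division returns 0.\<close>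

definition noisy_estimate ::
  "(real ^ 'k::finite \<Rightarrow> real ^ 'd::finite) \<Rightarrow> real \<Rightarrow> real \<Rightarrow> real \<Rightarrow> 'k obs list
     \<Rightarrow> real ^ 'd \<Rightarrow> (nat \<Rightarrow> real) \<Rightarrow> real"
where
  "noisy_estimate \<phi> \<alpha> \<beta> \<eta> D \<theta> \<nu> =
     (let w = trunc_weight \<phi> \<alpha> \<beta> \<eta> \<theta> in
        ((\<Sum>(x, z, y)\<leftarrow>D. z * w x 1 * y) + \<nu> 1) / ((\<Sum>(x, z, y)\<leftarrow>D. z * w x 1) + \<nu> 2)
      - ((\<Sum>(x, z, y)\<leftarrow>D. (1 - z) * w x 0 * y) + \<nu> 3) / ((\<Sum>(x, z, y)\<leftarrow>D. (1 - z) * w x 0) + \<nu> 4))"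

text \<open>
  The law of the released estimate.  The product measure makes the four noise variables
  independent of each other and of the first-stage draw.
\<close>

definition two_stage ::
  "(real ^ 'k::finite \<Rightarrow> real ^ 'd::finite) \<Rightarrow> (real ^ 'd) set \<Rightarrow> real \<Rightarrow> real
     \<Rightarrow> (real ^ 'd \<Rightarrow> real) \<Rightarrow> real \<Rightarrow> real \<Rightarrow> real \<Rightarrow> (nat \<Rightarrow> real) \<Rightarrow> 'k obs list \<Rightarrow> real measure"
where
  "two_stage \<phi> \<Theta> \<alpha> \<beta> \<Delta> \<eta> \<epsilon> p q D =
     distr (proportional_to \<Theta> (kng_weight \<phi> \<alpha> \<beta> \<Delta> (p * \<epsilon>) D)
              \<Otimes>\<^sub>M (\<Pi>\<^sub>M j\<in>{1..4}. laplace 0 (1 / ((1 - p) * q j * \<epsilon> * \<eta>))))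
       borel (\<lambda>(\<theta>, \<nu>). noisy_estimate \<phi> \<alpha> \<beta> \<eta> D \<theta> \<nu>)"

end

theory Submission
  imports Defs
begin

text \<open>
  Fix adjacent databases \<open>D\<close>, \<open>D'\<close>.  Passing from \<open>D\<close> to \<open>D'\<close> changes the first-stage weight by a
  factor at most \<open>exp (p\<epsilon>/2)\<close>, hence the normalizing constant too, so the law of the draw changes by
  a factor at most \<open>exp (p\<epsilon>)\<close>.  For a fixed draw all weights lie in \<open>[0, 1/\<eta>]\<close>, so each of the four
  sums moves by at most \<open>1/\<eta>\<close>; absorbing this move into its Laplace variable costs a factor
  \<open>exp ((1-p) q\<^sub>j \<epsilon>)\<close>, and the four factors multiply to \<open>exp ((1-p)\<epsilon>)\<close>.  Fubini combines both stages.
\<close>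

subsection \<open>The released sums\<close>

text \<open>Indexing the four summands by \<open>j\<close>, in step with the noise
  \<open>\<nu> j\<close>, lets one bound and one shift argument treat all four sums at once. Every
  index other than 1, 2 and 3 falls to the fourth term, so the bounds below hold for all
  \<open>j\<close>.\<close>

definition release_term ::
  "(real ^ 'k::finite \<Rightarrow> real \<Rightarrow> real) \<Rightarrow> nat \<Rightarrow> 'k obs \<Rightarrow> real"
where
  "release_term w j = (\<lambda>(x, z, y).
     if j = 1 then z * w x 1 * y else if j = 2 then z * w x 1
     else if j = 3 then (1 - z) * w x 0 * y else (1 - z) * w x 0)"

definition release_sum ::
  "(real ^ 'k::finite \<Rightarrow> real \<Rightarrow> real) \<Rightarrow> 'k obs list \<Rightarrow> nat \<Rightarrow> real"
where
  "release_sum w D j = (\<Sum>r\<leftarrow>D. release_term w j r)"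

text \<open>Each noise coordinate enters only through its own sum plus noise, so a change in that
  sum can be absorbed by translating the coordinate.\<close>

lemma noisy_estimate_eq:
  "noisy_estimate \<phi> \<alpha> \<beta> \<eta> D \<theta> \<nu>
    = (release_sum (trunc_weight \<phi> \<alpha> \<beta> \<eta> \<theta>) D 1 + \<nu> 1) / (release_sum (trunc_weight \<phi> \<alpha> \<beta> \<eta> \<theta>) D 2 + \<nu> 2)
    - (release_sum (trunc_weight \<phi> \<alpha> \<beta> \<eta> \<theta>) D 3 + \<nu> 3) / (release_sum (trunc_weight \<phi> \<alpha> \<beta> \<eta> \<theta>) D 4 + \<nu> 4)"
  by (simp add: noisy_estimate_def release_sum_def release_term_def Let_def)

text \<open>As \<open>z\<close> is binary, one summand of the last factor vanishes, and the four
  exponent pairs leave only seven possible values. Each is at most \<open>1 / \<eta>\<close> because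
  both \<open>e\<close> and \<open>1 - e\<close> are at least \<open>\<eta>\<close>.\<close>

lemma weight_bounds:
  assumes "0 < \<eta>" and "\<eta> \<le> e" and "e \<le> 1 - \<eta>" and "z \<in> {0, 1}"
    and "(\<alpha>, \<beta>) \<in> {(-1, -1), (-1, 0), (0, -1), (0, 0)}"
  shows "weight \<alpha> \<beta> e z \<in> {0..1 / \<eta>}"
proof -
  have e: "0 < e" "e < 1"
    using assms by linarith+
  have "0 \<le> z * (1 - e) + (1 - z) * e"
    using assms(4) e by (elim insertE emptyE; simp)
  then have nonneg: "0 \<le> weight \<alpha> \<beta> e z"
    unfolding weight_def by (intro mult_nonneg_nonneg powr_ge_zero)
  have le: "1 / e \<le> 1 / \<eta>" "1 / (1 - e) \<le> 1 / \<eta>" "1 \<le> 1 / \<eta>"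
    using e assms(1-3) by (simp_all add: frac_le)
  have "(1 - e) / e \<le> 1 / e" "e / (1 - e) \<le> 1 / (1 - e)"
    using e by (simp_all add: divide_right_mono)
  note le = le order_trans[OF this(1) le(1)] order_trans[OF this(2) le(2)]
  have powr: "e powr -1 = 1 / e" "(1 - e) powr -1 = 1 / (1 - e)" "e powr 0 = 1" "(1 - e) powr 0 = 1"
    using e by (simp_all add: powr_neg_one)
  have "weight \<alpha> \<beta> e z \<in> {1 / e, 1 / (1 - e), (1 - e) / e, e / (1 - e), 1, e, 1 - e}"
    using assms(4,5) e unfolding weight_def by (elim insertE emptyE Pair_inject; simp add: powr)
  then have "weight \<alpha> \<beta> e z \<le> 1 / \<eta>"
    using e le by (elim insertE emptyE; linarith)
  with nonneg show ?thesis
    by simp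
qed

text \<open>The bound \<open>\<eta> \<le> 1 / 2\<close> makes the interval from
  \<open>\<eta>\<close> to \<open>1 - \<eta>\<close> nonempty, so the nested maximum and minimum
  really land in it.\<close>

lemma trunc_weight_bounds:
  assumes "0 < \<eta>" and "\<eta> \<le> 1 / 2" and "z \<in> {0, 1}"
    and "(\<alpha>, \<beta>) \<in> {(-1, -1), (-1, 0), (0, -1), (0, 0)}"
  shows "trunc_weight \<phi> \<alpha> \<beta> \<eta> \<theta> x z \<in> {0..1 / \<eta>}"
  unfolding trunc_weight_def trunc_def
  by (rule weight_bounds[OF assms(1) _ _ assms(3,4)]) (use assms(1,2) in simp_all)

lemma release_term_bounds:
  assumes "r \<in> records" and "\<And>x z. z \<in> {0, 1} \<Longrightarrow> w x z \<in> {0..c}"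
  shows "release_term w j r \<in> {0..c}"
proof -
  obtain x z y where r: "r = (x, z, y)" and z: "z = 0 \<or> z = 1" and y: "0 \<le> y" "y \<le> 1"
    using assms(1) by (auto simp: records_def)
  have w: "0 \<le> w x 0" "w x 0 \<le> c" "0 \<le> w x 1" "w x 1 \<le> c"
    using assms(2)[of 0 x] assms(2)[of 1 x] by simp_all
  have "w x 0 * y \<le> w x 0" "w x 1 * y \<le> w x 1" "0 \<le> w x 0 * y" "0 \<le> w x 1 * y"
    using w y by (auto intro: mult_left_le)
  with w have "w x 0 * y \<in> {0..c}" "w x 1 * y \<in> {0..c}" "w x 0 \<in> {0..c}" "w x 1 \<in> {0..c}" "0 \<in> {0..c}"
    unfolding atLeastAtMost_iff by linarith+
  moreover have "release_term w j r \<in> {z * w x 1 * y, z * w x 1, (1 - z) * w x 0 * y, (1 - z) * w x 0}"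
    unfolding r release_term_def by simp
  ultimately show ?thesis
    using z by (elim disjE insertE emptyE) (simp_all only: mult_1 mult_zero_left diff_self diff_zero)
qed

section \<open>Sensitivity of sums over adjacent databases\<close>

lemma hamming_1_cases:
  assumes "hamming D D' = 1"
  obtains i where "i < length D" and "\<And>j. j < length D \<Longrightarrow> j \<noteq> i \<Longrightarrow> D ! j = D' ! j"
proof -
  obtain i where "{i. i < length D \<and> D ! i \<noteq> D' ! i} = {i}"
    using assms unfolding hamming_def by (auto simp: card_1_singleton_iff)
  then show thesis
    by (intro that[of i]) auto
qed

text \<open>Only the differing position survives in the difference. Its two terms lie in the same
  interval starting at 0, which gives the sensitivity \<open>c\<close> instead of the
  \<open>2 * c\<close> that a bound on absolute values would give.\<close>

lemma adjacent_sum_list_diff_le: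
  fixes h :: "'r \<Rightarrow> real"
  assumes "adjacent R n D D'" and h: "\<And>r. r \<in> R \<Longrightarrow> h r \<in> {0..c}"
  shows "\<bar>(\<Sum>r\<leftarrow>D. h r) - (\<Sum>r\<leftarrow>D'. h r)\<bar> \<le> c"
proof -
  have len: "length D = n" "length D' = n" and R: "set D \<subseteq> R" "set D' \<subseteq> R"
    and "hamming D D' = 1"
    using assms(1) by (auto simp: adjacent_def databases_def)
  then obtain i where i: "i < n" and same: "\<And>j. j < n \<Longrightarrow> j \<noteq> i \<Longrightarrow> D ! j = D' ! j"
    by (metis hamming_1_cases)
  have "(\<Sum>r\<leftarrow>D. h r) - (\<Sum>r\<leftarrow>D'. h r) = (\<Sum>j<n. h (D ! j) - h (D' ! j))"
    by (simp add: sum_list_sum_nth len sum_subtractf atLeast0LessThan)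
  also have "\<dots> = (\<Sum>j\<in>{i}. h (D ! j) - h (D' ! j))"
    using i same by (intro sum.mono_neutral_right) auto
  finally have eq: "(\<Sum>r\<leftarrow>D. h r) - (\<Sum>r\<leftarrow>D'. h r) = h (D ! i) - h (D' ! i)"
    by simp
  have "D ! i \<in> R" "D' ! i \<in> R"
    using R len i by (auto dest: nth_mem)
  with h[of "D ! i"] h[of "D' ! i"] show ?thesis
    unfolding eq by (auto simp: abs_le_iff)
qed

text \<open>\<open>hamming\<close> ranges over the positions of its first argument, so symmetry
  rests on the equal lengths. The reverse direction serves to compare the normalizing
  constants.\<close>

lemma adjacent_sym: "adjacent R n D D' \<Longrightarrow> adjacent R n D' D"
proof -
  assume a: "adjacent R n D D'"
  then have "hamming D' D = hamming D D'"
    by (auto simp: adjacent_def databases_def hamming_def eq_commute)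
  with a show ?thesis
    by (simp add: adjacent_def)
qed

section \<open>Joint measurability of the estimate\<close>

lemma measurable_lebesgue_on_borel:
  assumes "f \<in> borel_measurable borel"
  shows "f \<in> borel_measurable (lebesgue_on S)"
  using assms by (intro measurable_restrict_space1 measurable_completion) simp

lemma borel_measurable_trunc_weight [measurable]:
  "(\<lambda>\<theta>. trunc_weight \<phi> \<alpha> \<beta> \<eta> \<theta> x z) \<in> borel_measurable borel"
  unfolding trunc_weight_def weight_def trunc_def propensity_def by measurable

text \<open>The sums are Borel in \<open>\<theta>\<close> and hence measurable for the Lebesgue sets
  of \<open>\<Theta>\<close>. The noise factors are plain \<open>borel\<close>, which has the same
  sets as every Laplace law.\<close>

lemma borel_measurable_noisy_estimate:
  assumes "{1..4} \<subseteq> J"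
  shows "(\<lambda>(\<theta>, \<nu>). noisy_estimate \<phi> \<alpha> \<beta> \<eta> D \<theta> \<nu>)
    \<in> borel_measurable (lebesgue_on \<Theta> \<Otimes>\<^sub>M (\<Pi>\<^sub>M j\<in>J. borel))"
proof -
  have term_meas: "(\<lambda>\<theta>. release_term (trunc_weight \<phi> \<alpha> \<beta> \<eta> \<theta>) j r) \<in> borel_measurable borel" for j r
    by (cases r) (simp add: release_term_def)
  have [measurable]: "(\<lambda>\<theta>. release_sum (trunc_weight \<phi> \<alpha> \<beta> \<eta> \<theta>) D j)
      \<in> borel_measurable (lebesgue_on \<Theta>)" for j
    unfolding release_sum_def
    by (rule measurable_lebesgue_on_borel, induction D) (auto intro!: borel_measurable_add term_meas)
  have [measurable]: "1 \<in> J" "2 \<in> J" "3 \<in> J" "4 \<in> J"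
    using assms by auto
  show ?thesis
    unfolding noisy_estimate_eq by measurable
qed

subsection \<open>Shifting Laplace noise\<close>

lemma space_laplace [simp]: "space (laplace m b) = UNIV"
  by (simp add: laplace_def)

lemma sets_laplace [simp, measurable_cong]: "sets (laplace m b) = sets borel"
  by (simp add: laplace_def)

text \<open>On the nonnegative half-line the centred density is half an exponential density of rate
  \<open>1 / b\<close>, so it contributes mass \<open>1 / 2\<close>; evenness doubles this, and
  translation invariance of \<open>lborel\<close> handles the mean \<open>m\<close>.\<close>

lemma prob_space_laplace:
  assumes "b > 0"
  shows "prob_space (laplace m b)"
proof
  let ?g = "\<lambda>t::real. exp (- \<bar>t\<bar> / b) / (2 * b)"
  have eq: "indicator {0..} t *\<^sub>R ?g t = exponential_density (1 / b) t / 2" for t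
    by (auto simp: exponential_density_def indicator_def)
  have "prob_space (density lborel (exponential_density (1 / b)))"
    using assms by (intro prob_space_exponential_density) simp
  from prob_space.emeasure_space_1[OF this]
  have "(\<integral>\<^sup>+t. ennreal (exponential_density (1 / b) t) \<partial>lborel) = 1"
    by (simp add: emeasure_density)
  then have "has_bochner_integral lborel (exponential_density (1 / b)) 1"
    using assms by (intro has_bochner_integral_nn_integral) (auto simp: exponential_density_nonneg)
  then have "has_bochner_integral lborel (\<lambda>t. indicator {0..} t *\<^sub>R ?g t) (1 / 2)"
    unfolding eq by (rule has_bochner_integral_divide_zero)
  from has_bochner_integral_even_function[OF this]
  have 1: "has_bochner_integral lborel ?g 1"
    by simp
  have "(\<integral>\<^sup>+t. ennreal (?g (t - m)) \<partial>lborel) = (\<integral>\<^sup>+t. ennreal (?g t) \<partial>lborel)"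
    using nn_integral_real_affine[of "\<lambda>t. ennreal (?g (t - m))" 1 m] by simp
  also have "\<dots> = ennreal (\<integral>t. ?g t \<partial>lborel)"
    using 1 assms by (intro nn_integral_eq_integral) (auto simp: has_bochner_integral_iff)
  also have "\<dots> = 1"
    using 1 by (simp add: has_bochner_integral_iff)
  finally show "emeasure (laplace m b) (space (laplace m b)) = 1"
    by (simp add: laplace_def emeasure_density)
qed

text \<open>A substitution moves the shift from \<open>f\<close> to the density, where the triangle
  inequality bounds the change of the exponent by \<open>\<bar>s\<bar> / b\<close>. Arbitrary
  nonnegative integrands, not just indicators, are allowed so that the bound can be used inside
  iterated integrals.\<close>

lemma nn_integral_laplace_shift_le:
  assumes "b > 0" and [measurable]: "f \<in> borel_measurable borel"
  shows "(\<integral>\<^sup>+t. f (t + s) \<partial>laplace m b) \<le> ennreal (exp (\<bar>s\<bar> / b)) * (\<integral>\<^sup>+t. f t \<partial>laplace m b)"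
proof -
  define g where "g t = exp (- \<bar>t - m\<bar> / b) / (2 * b)" for t
  have [measurable]: "g \<in> borel_measurable borel"
    unfolding g_def by measurable
  have g_shift: "g (t - s) \<le> exp (\<bar>s\<bar> / b) * g t" for t
  proof -
    have "- \<bar>t - s - m\<bar> / b \<le> \<bar>s\<bar> / b + - \<bar>t - m\<bar> / b"
      using assms(1) by (simp add: field_simps)
    then have "exp (- \<bar>t - s - m\<bar> / b) \<le> exp (\<bar>s\<bar> / b) * exp (- \<bar>t - m\<bar> / b)"
      by (simp flip: exp_add)
    then show ?thesis
      using assms(1) unfolding g_def by (simp add: divide_right_mono)
  qed
  have "(\<integral>\<^sup>+t. f (t + s) \<partial>laplace m b) = (\<integral>\<^sup>+t. ennreal (g t) * f (t + s) \<partial>lborel)"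
    unfolding laplace_def g_def by (subst nn_integral_density) auto
  also have "\<dots> = (\<integral>\<^sup>+t. ennreal (g (t - s)) * f t \<partial>lborel)"
    by (subst nn_integral_real_affine[where c = 1 and t = "- s"]) (auto simp: add.commute)
  also have "\<dots> \<le> (\<integral>\<^sup>+t. ennreal (exp (\<bar>s\<bar> / b)) * (ennreal (g t) * f t) \<partial>lborel)"
  proof (intro nn_integral_mono)
    fix t
    have "ennreal (g (t - s)) \<le> ennreal (exp (\<bar>s\<bar> / b)) * ennreal (g t)"
      using g_shift[of t] by (simp add: ennreal_leI flip: ennreal_mult')
    then show "ennreal (g (t - s)) * f t \<le> ennreal (exp (\<bar>s\<bar> / b)) * (ennreal (g t) * f t)"
      by (metis mult.assoc mult_right_mono zero_le)
  qed
  also have "\<dots> = ennreal (exp (\<bar>s\<bar> / b)) * (\<integral>\<^sup>+t. ennreal (g t) * f t \<partial>lborel)"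
    by (rule nn_integral_cmult) measurable
  also have "(\<integral>\<^sup>+t. ennreal (g t) * f t \<partial>lborel) = (\<integral>\<^sup>+t. f t \<partial>laplace m b)"
    unfolding laplace_def g_def by (subst nn_integral_density) auto
  finally show ?thesis .
qed

text \<open>One-coordinate bounds tensorize: Fubini splits off a coordinate, its bound is applied to
  the inner integral, and the induction hypothesis treats the rest. The integrand must be arbitrary
  in the induction because it changes from \<open>f\<close> to a partial integral.\<close>

lemma product_nn_integral_map_le:
  assumes M: "product_sigma_finite M"
    and "finite I"
    and "\<And>i. i \<in> I \<Longrightarrow> T i \<in> measurable (M i) (M i)"
    and "\<And>i g. i \<in> I \<Longrightarrow> g \<in> borel_measurable (M i) \<Longrightarrow>
           (\<integral>\<^sup>+x. g (T i x) \<partial>M i) \<le> c i * (\<integral>\<^sup>+x. g x \<partial>M i)"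
    and "f \<in> borel_measurable (Pi\<^sub>M I M)"
  shows "(\<integral>\<^sup>+x. f (\<lambda>i\<in>I. T i (x i)) \<partial>Pi\<^sub>M I M) \<le> (\<Prod>i\<in>I. c i) * (\<integral>\<^sup>+x. f x \<partial>Pi\<^sub>M I M)"
  using assms(2-)
proof (induction I arbitrary: f rule: finite_induct)
  case empty
  then show ?case
    by (simp add: PiM_empty nn_integral_count_space_finite)
next
  case (insert i I)
  note [measurable] = insert.prems(3) insert.prems(1)
  have T_meas [measurable]: "\<And>j. j \<in> I \<Longrightarrow> T j \<in> measurable (M j) (M j)" "T i \<in> measurable (M i) (M i)"
    using insert.prems(1) by auto
  have restrict_meas [measurable]:
    "(\<lambda>x. \<lambda>j\<in>J. T j (x j)) \<in> measurable (Pi\<^sub>M J M) (Pi\<^sub>M J M)" if "J \<subseteq> insert i I" for J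
    using that insert.prems(1) by (intro measurable_restrict) (auto intro: measurable_compose[OF measurable_component_singleton])
  have M_i: "sigma_finite_measure (M i)"
    using M by (rule product_sigma_finite.sigma_finite_measures)
  \<comment> \<open>This is the function of the remaining coordinates to which the induction
    hypothesis is applied.\<close>
  define g where "g x = (\<integral>\<^sup>+y. f (x(i := y)) \<partial>M i)" for x
  have g_meas: "g \<in> borel_measurable (Pi\<^sub>M I M)"
    unfolding g_def by (rule sigma_finite_measure.borel_measurable_nn_integral[OF M_i]) measurable
  have "(\<integral>\<^sup>+x. f (\<lambda>j\<in>insert i I. T j (x j)) \<partial>Pi\<^sub>M (insert i I) M)
      = (\<integral>\<^sup>+x. \<integral>\<^sup>+y. f (\<lambda>j\<in>insert i I. T j ((x(i := y)) j)) \<partial>M i \<partial>Pi\<^sub>M I M)"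
    using insert.hyps measurable_compose[OF restrict_meas[OF order_refl] insert.prems(3)]
    by (intro product_sigma_finite.product_nn_integral_insert[OF M]) auto
  also have "\<dots> = (\<integral>\<^sup>+x. \<integral>\<^sup>+y. f ((\<lambda>j\<in>I. T j (x j))(i := T i y)) \<partial>M i \<partial>Pi\<^sub>M I M)"
    using insert.hyps(2) by (intro nn_integral_cong arg_cong[where f = f]) (auto simp: fun_eq_iff)
  also have "\<dots> \<le> (\<integral>\<^sup>+x. c i * g (\<lambda>j\<in>I. T j (x j)) \<partial>Pi\<^sub>M I M)"
  proof (intro nn_integral_mono)
    fix x assume "x \<in> space (Pi\<^sub>M I M)"
    then have [measurable]: "(\<lambda>j\<in>I. T j (x j)) \<in> space (Pi\<^sub>M I M)"
      by (rule measurable_space[OF restrict_meas[OF subset_insertI]])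
    show "(\<integral>\<^sup>+y. f ((\<lambda>j\<in>I. T j (x j))(i := T i y)) \<partial>M i) \<le> c i * g (\<lambda>j\<in>I. T j (x j))"
      unfolding g_def by (rule insert.prems(2)) (simp, measurable)
  qed
  also have "\<dots> = c i * (\<integral>\<^sup>+x. g (\<lambda>j\<in>I. T j (x j)) \<partial>Pi\<^sub>M I M)"
    by (intro nn_integral_cmult measurable_compose[OF restrict_meas[OF subset_insertI] g_meas])
  also have "\<dots> \<le> c i * ((\<Prod>j\<in>I. c j) * (\<integral>\<^sup>+x. g x \<partial>Pi\<^sub>M I M))"
    using insert.prems g_meas by (intro mult_left_mono insert.IH) auto
  also have "(\<integral>\<^sup>+x. g x \<partial>Pi\<^sub>M I M) = (\<integral>\<^sup>+x. f x \<partial>Pi\<^sub>M (insert i I) M)"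
    unfolding g_def using insert.hyps insert.prems(3) by (intro product_sigma_finite.product_nn_integral_insert[OF M, symmetric])
  finally show ?case
    using insert.hyps by (simp add: mult.assoc)
qed

subsection \<open>Ratio of normalized densities\<close>

lemma space_proportional_to [simp]: "space (proportional_to \<Theta> g) = \<Theta>"
  by (simp add: proportional_to_def)

lemma sets_proportional_to [measurable_cong]: "sets (proportional_to \<Theta> g) = sets (lebesgue_on \<Theta>)"
  by (simp add: proportional_to_def)

lemma prob_space_proportional_to:
  assumes "normalizable \<Theta> g" and "\<And>\<theta>. \<theta> \<in> \<Theta> \<Longrightarrow> 0 \<le> g \<theta>"
  shows "prob_space (proportional_to \<Theta> g)"
proof
  let ?c = "\<integral>t. g t \<partial>lebesgue_on \<Theta>"
  have int: "integrable (lebesgue_on \<Theta>) g" and pos: "0 < ?c"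
    using assms(1) by (auto simp: normalizable_def)
  then have "(\<integral>\<^sup>+\<theta>. ennreal (g \<theta> / ?c) \<partial>lebesgue_on \<Theta>) = ennreal (\<integral>\<theta>. g \<theta> / ?c \<partial>lebesgue_on \<Theta>)"
    using assms(2) by (intro nn_integral_eq_integral) (auto intro!: AE_I2)
  also have "\<dots> = 1"
    using pos by simp
  finally show "emeasure (proportional_to \<Theta> g) (space (proportional_to \<Theta> g)) = 1"
    using borel_measurable_integrable[OF int] unfolding proportional_to_def
    by (subst emeasure_density) (auto simp: nn_integral_set_ennreal cong: nn_integral_cong_simp)
qed

text \<open>One factor \<open>k\<close> comes from the pointwise comparison \<open>gh\<close>; the
  other comes from the normalizing constants, which \<open>hg\<close> compares in the opposite
  direction. Together they give the square.\<close>

lemma nn_integral_proportional_to_le: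
  assumes "normalizable \<Theta> g" and "normalizable \<Theta> h"
    and nonneg: "\<And>\<theta>. \<theta> \<in> \<Theta> \<Longrightarrow> 0 \<le> h \<theta>"
    and gh: "\<And>\<theta>. \<theta> \<in> \<Theta> \<Longrightarrow> g \<theta> \<le> k * h \<theta>" and hg: "\<And>\<theta>. \<theta> \<in> \<Theta> \<Longrightarrow> h \<theta> \<le> k * g \<theta>"
    and "0 \<le> k" and f: "f \<in> borel_measurable (lebesgue_on \<Theta>)"
  shows "(\<integral>\<^sup>+\<theta>. f \<theta> \<partial>proportional_to \<Theta> g) \<le> ennreal (k\<^sup>2) * (\<integral>\<^sup>+\<theta>. f \<theta> \<partial>proportional_to \<Theta> h)"
proof -
  let ?L = "lebesgue_on \<Theta>"
  define a where "a = (\<integral>t. g t \<partial>?L)"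
  define b where "b = (\<integral>t. h t \<partial>?L)"
  have int: "integrable ?L g" "integrable ?L h" and pos: "0 < a" "0 < b"
    using assms(1,2) by (auto simp: normalizable_def a_def b_def)
  note [measurable] = f int[THEN borel_measurable_integrable]
  have "b \<le> (\<integral>t. k * g t \<partial>?L)"
    unfolding b_def using int hg by (intro integral_mono) auto
  then have b_le: "b \<le> k * a"
    by (simp add: a_def)
  have ratio: "g \<theta> / a \<le> k\<^sup>2 * (h \<theta> / b)" if "\<theta> \<in> \<Theta>" for \<theta>
  proof -
    have "g \<theta> * b \<le> (k * h \<theta>) * b"
      using gh[OF that] pos by (intro mult_right_mono) auto
    also have "\<dots> \<le> (k * h \<theta>) * (k * a)"
      using nonneg[OF that] assms(6) b_le by (intro mult_left_mono) auto
    finally show ?thesis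
      using pos by (simp add: field_simps power2_eq_square)
  qed
  have "(\<integral>\<^sup>+\<theta>. f \<theta> \<partial>proportional_to \<Theta> g) = (\<integral>\<^sup>+\<theta>. ennreal (g \<theta> / a) * f \<theta> \<partial>?L)"
    unfolding proportional_to_def a_def[symmetric] by (rule nn_integral_density) measurable
  also have "\<dots> \<le> (\<integral>\<^sup>+\<theta>. ennreal (k\<^sup>2) * (ennreal (h \<theta> / b) * f \<theta>) \<partial>?L)"
  proof (intro nn_integral_mono)
    fix \<theta> assume "\<theta> \<in> space ?L"
    then have "ennreal (g \<theta> / a) \<le> ennreal (k\<^sup>2) * ennreal (h \<theta> / b)"
      using ratio[of \<theta>] by (simp add: ennreal_leI flip: ennreal_mult')
    then show "ennreal (g \<theta> / a) * f \<theta> \<le> ennreal (k\<^sup>2) * (ennreal (h \<theta> / b) * f \<theta>)"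
      by (metis mult.assoc mult_right_mono zero_le)
  qed
  also have "\<dots> = ennreal (k\<^sup>2) * (\<integral>\<^sup>+\<theta>. ennreal (h \<theta> / b) * f \<theta> \<partial>?L)"
    by (rule nn_integral_cmult) measurable
  also have "(\<integral>\<^sup>+\<theta>. ennreal (h \<theta> / b) * f \<theta> \<partial>?L) = (\<integral>\<^sup>+\<theta>. f \<theta> \<partial>proportional_to \<Theta> h)"
    unfolding proportional_to_def b_def[symmetric] by (rule nn_integral_density[symmetric]) measurable
  finally show ?thesis .
qed

text \<open>By the reverse triangle inequality the gradient norm changes by at most
  \<open>\<Delta> \<theta>\<close>, which cancels against the denominator of the exponent. The
  remaining \<open>b / 2\<close> is half the budget; the normalizing constant takes the other
  half.\<close>

lemma kng_weight_le:
  assumes "0 < \<Delta> \<theta>" and "0 \<le> b"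
    and "norm (grad_score \<phi> \<alpha> \<beta> \<theta> D - grad_score \<phi> \<alpha> \<beta> \<theta> D') \<le> \<Delta> \<theta>"
  shows "kng_weight \<phi> \<alpha> \<beta> \<Delta> b D \<theta> \<le> exp (b / 2) * kng_weight \<phi> \<alpha> \<beta> \<Delta> b D' \<theta>"
proof -
  let ?G = "\<lambda>D. norm (grad_score \<phi> \<alpha> \<beta> \<theta> D)"
  have "?G D' - ?G D \<le> \<Delta> \<theta>"
    using norm_triangle_ineq2[of "grad_score \<phi> \<alpha> \<beta> \<theta> D'" "grad_score \<phi> \<alpha> \<beta> \<theta> D"] assms(3)
    by (simp add: norm_minus_commute)
  then have "(b / (2 * \<Delta> \<theta>)) * (?G D' - ?G D) \<le> (b / (2 * \<Delta> \<theta>)) * \<Delta> \<theta>"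
    using assms(1,2) by (intro mult_left_mono) auto
  also have "\<dots> = b / 2"
    using assms(1) by simp
  finally show ?thesis
    unfolding kng_weight_def by (simp add: algebra_simps flip: exp_add)
qed

subsection \<open>Combining the two stages\<close>

theorem proposition3:
  fixes \<epsilon> p \<eta> \<alpha> \<beta> C\<^sub>\<phi> :: real
    and q :: "nat \<Rightarrow> real"
    and n :: nat
    and \<Theta> :: "(real ^ 'd::finite) set"
    and \<phi> :: "real ^ 'k::finite \<Rightarrow> real ^ 'd"
    and \<Delta> :: "real ^ 'd \<Rightarrow> real"
  assumes "\<epsilon> > 0" and "0 < p" and "p < 1"
    and "\<And>j. j \<in> {1..4} \<Longrightarrow> 0 < q j \<and> q j < 1" and "(\<Sum>j=1..4. q j) = 1"
    and "0 < \<eta>" and "\<eta> \<le> 1 / 2"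
    and "(\<alpha>, \<beta>) \<in> {(-1, -1), (-1, 0), (0, -1), (0, 0)}"
    and "convex \<Theta>"
    and "\<And>x. norm x \<le> 1 \<Longrightarrow> norm (\<phi> x) \<le> C\<^sub>\<phi>"
    and "\<And>\<theta>. \<theta> \<in> \<Theta> \<Longrightarrow> 0 < \<Delta> \<theta>"
    and "\<And>\<theta> D D'. \<theta> \<in> \<Theta> \<Longrightarrow> adjacent records n D D' \<Longrightarrow>
           norm (grad_score \<phi> \<alpha> \<beta> \<theta> D - grad_score \<phi> \<alpha> \<beta> \<theta> D') \<le> \<Delta> \<theta>"
    and "\<And>D. D \<in> databases records n \<Longrightarrow>
           integrable (lebesgue_on \<Theta>) (\<lambda>\<theta>. exp (- (1 / \<Delta> \<theta>) * norm (grad_score \<phi> \<alpha> \<beta> \<theta> D)))"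
    and "\<And>D. D \<in> databases records n \<Longrightarrow>
           normalizable \<Theta> (kng_weight \<phi> \<alpha> \<beta> \<Delta> (p * \<epsilon>) D)"
  shows "differentially_private records n borel \<epsilon> (two_stage \<phi> \<Theta> \<alpha> \<beta> \<Delta> \<eta> \<epsilon> p q)"
proof -
  let ?w = "trunc_weight \<phi> \<alpha> \<beta> \<eta>"
  let ?P = "\<lambda>D. proportional_to \<Theta> (kng_weight \<phi> \<alpha> \<beta> \<Delta> (p * \<epsilon>) D)"
  let ?F = "noisy_estimate \<phi> \<alpha> \<beta> \<eta>"
  define b where "b j = 1 / ((1 - p) * q j * \<epsilon> * \<eta>)" for j
  \<comment> \<open>Scale 1 off the index set, because \<open>product_sigma_finite\<close> quantifies over all indices.\<close>
  define M where "M j = laplace 0 (if j \<in> {1..4::nat} then b j else 1)" for j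
  define L where "L = Pi\<^sub>M {1..4} M"
  have b_pos: "0 < b j" if "j \<in> {1..4}" for j
    using assms(1,3,6) assms(4)[OF that] by (simp add: b_def)
  have sets_M [measurable_cong, simp]: "sets (M j) = sets borel" for j
    by (simp add: M_def)
  have M_prob: "prob_space (M j)" for j
    using b_pos by (auto intro!: prob_space_laplace simp: M_def)
  then have M_finite: "product_sigma_finite M"
    by (intro product_sigma_finite.intro prob_space_imp_sigma_finite)
  have L_prob: "prob_space L"
    unfolding L_def by (intro prob_space_PiM M_prob)
  then have L_finite: "sigma_finite_measure L"
    by (rule prob_space_imp_sigma_finite)
  have L_eq: "(\<Pi>\<^sub>M j\<in>{1..4}. laplace 0 (1 / ((1 - p) * q j * \<epsilon> * \<eta>))) = L"
    unfolding L_def by (intro PiM_cong) (auto simp: M_def b_def)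
  have sets_L: "sets L = sets (\<Pi>\<^sub>M j\<in>{1..4::nat}. borel)"
    unfolding L_def by (intro sets_PiM_cong) auto
  have F_meas: "(\<lambda>(\<theta>, \<nu>). ?F D \<theta> \<nu>) \<in> borel_measurable (lebesgue_on \<Theta> \<Otimes>\<^sub>M L)" for D
    using borel_measurable_noisy_estimate[of "{1..4}" \<phi> \<alpha> \<beta> \<eta> D \<Theta>]
    by (simp cong: measurable_cong_sets sets_pair_measure_cong add: sets_L)
  have F_meas': "(\<lambda>(\<theta>, \<nu>). ?F D \<theta> \<nu>) \<in> borel_measurable (?P D' \<Otimes>\<^sub>M L)" for D D'
    using F_meas by (simp cong: measurable_cong_sets sets_pair_measure_cong add: sets_proportional_to)
  have P: "prob_space (?P D)" if "D \<in> databases records n" for D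
    using assms(14)[OF that] by (rule prob_space_proportional_to) (simp add: kng_weight_def)
  have two_stage_eq: "two_stage \<phi> \<Theta> \<alpha> \<beta> \<Delta> \<eta> \<epsilon> p q D
      = distr (?P D \<Otimes>\<^sub>M L) borel (\<lambda>(\<theta>, \<nu>). ?F D \<theta> \<nu>)" for D
    unfolding two_stage_def L_eq ..
  have prob: "prob_space (two_stage \<phi> \<Theta> \<alpha> \<beta> \<Delta> \<eta> \<epsilon> p q D)" if "D \<in> databases records n" for D
    unfolding two_stage_eq
    by (intro prob_space.prob_space_distr[OF _ F_meas'] prob_space_pair P L_prob that)
  \<comment> \<open>The conditional probability of \<open>B\<close> given the draw
    \<open>\<theta>\<close>: the output law becomes a mixture, and the two stages can be compared
    one at a time.\<close>
  define Q where "Q D B \<theta> = (\<integral>\<^sup>+\<nu>. indicator B (?F D \<theta> \<nu>) \<partial>L)" for D B \<theta>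
  have emeasure_eq: "emeasure (two_stage \<phi> \<Theta> \<alpha> \<beta> \<Delta> \<eta> \<epsilon> p q D) B = (\<integral>\<^sup>+\<theta>. Q D B \<theta> \<partial>?P D)"
    if B [measurable]: "B \<in> sets borel" for D B
  proof -
    have "emeasure (two_stage \<phi> \<Theta> \<alpha> \<beta> \<Delta> \<eta> \<epsilon> p q D) B
        = (\<integral>\<^sup>+t. indicator B t \<partial>distr (?P D \<Otimes>\<^sub>M L) borel (\<lambda>(\<theta>, \<nu>). ?F D \<theta> \<nu>))"
      unfolding two_stage_eq by simp
    also have "\<dots> = (\<integral>\<^sup>+z. indicator B ((\<lambda>(\<theta>, \<nu>). ?F D \<theta> \<nu>) z) \<partial>(?P D \<Otimes>\<^sub>M L))"
      by (rule nn_integral_distr[OF F_meas']) measurable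
    also have "\<dots> = (\<integral>\<^sup>+\<theta>. \<integral>\<^sup>+\<nu>. indicator B ((\<lambda>(\<theta>, \<nu>). ?F D \<theta> \<nu>) (\<theta>, \<nu>)) \<partial>L \<partial>?P D)"
      by (rule sigma_finite_measure.nn_integral_fst[OF L_finite, symmetric]) (rule measurable_compose[OF F_meas'], measurable)
    finally show ?thesis
      by (simp add: Q_def)
  qed
  have second_stage: "Q D B \<theta> \<le> ennreal (exp ((1 - p) * \<epsilon>)) * Q D' B \<theta>"
    if adj: "adjacent records n D D'" and [measurable]: "B \<in> sets borel" and \<theta>: "\<theta> \<in> \<Theta>" for D D' B \<theta>
  proof -
    \<comment> \<open>Both sums use the same draw and hence the same weight function, so only the
      changed record contributes to the displacement.\<close>
    define s where "s j = release_sum (?w \<theta>) D j - release_sum (?w \<theta>) D' j" for j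
    have s: "\<bar>s j\<bar> \<le> 1 / \<eta>" for j
      unfolding s_def release_sum_def using adj
      by (rule adjacent_sum_list_diff_le)
         (use release_term_bounds[where w = "?w \<theta>"] trunc_weight_bounds[OF assms(6,7) _ assms(8)] in blast)
    have shift: "(\<integral>\<^sup>+t. g (t + s j) \<partial>M j) \<le> ennreal (exp ((1 - p) * q j * \<epsilon>)) * (\<integral>\<^sup>+t. g t \<partial>M j)"
      if "j \<in> {1..4}" and g: "g \<in> borel_measurable (M j)" for j g
    proof -
      have M_j: "M j = laplace 0 (b j)"
        using that(1) by (simp add: M_def)
      have "\<bar>s j\<bar> / b j \<le> (1 / \<eta>) / b j"
        using s b_pos[OF that(1)] by (intro divide_right_mono) auto
      \<comment> \<open>The Laplace scale is calibrated for this: \<open>1 / \<eta>\<close> divided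
        by \<open>b j\<close> is exactly the budget share of coordinate \<open>j\<close>.\<close>
      also have "\<dots> = (1 - p) * q j * \<epsilon>"
        using assms(6) by (simp add: b_def)
      finally have "ennreal (exp (\<bar>s j\<bar> / b j)) \<le> ennreal (exp ((1 - p) * q j * \<epsilon>))"
        by (simp add: ennreal_leI)
      moreover have "(\<integral>\<^sup>+t. g (t + s j) \<partial>M j) \<le> ennreal (exp (\<bar>s j\<bar> / b j)) * (\<integral>\<^sup>+t. g t \<partial>M j)"
        using g b_pos[OF that(1)] unfolding M_j by (intro nn_integral_laplace_shift_le) auto
      ultimately show ?thesis
        by (meson mult_right_mono order_trans zero_le)
    qed
    have "(\<lambda>\<nu>. (\<lambda>(\<theta>, \<nu>). ?F D' \<theta> \<nu>) (\<theta>, \<nu>)) \<in> borel_measurable L"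
      using \<theta> by (intro measurable_compose[OF measurable_Pair1' F_meas]) auto
    then have [measurable]: "?F D' \<theta> \<in> borel_measurable L"
      by simp
    \<comment> \<open>For a fixed draw, the estimate on \<open>D\<close> with noise
      \<open>\<nu>\<close> is the estimate on \<open>D'\<close> with noise translated by
      \<open>s\<close>.\<close>
    have "Q D B \<theta> = (\<integral>\<^sup>+\<nu>. indicator B (?F D' \<theta> (\<lambda>j\<in>{1..4}. \<nu> j + s j)) \<partial>L)"
      unfolding Q_def
      by (intro nn_integral_cong arg_cong[where f = "indicator B"])
         (simp add: noisy_estimate_eq s_def add_ac)
    also have "\<dots> \<le> (\<Prod>j=1..4. ennreal (exp ((1 - p) * q j * \<epsilon>))) * Q D' B \<theta>"
      unfolding Q_def L_def
    proof (rule product_nn_integral_map_le[OF M_finite, where T = "\<lambda>j t. t + s j"])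
      show "(\<lambda>\<nu>. indicator B (?F D' \<theta> \<nu>)) \<in> borel_measurable (Pi\<^sub>M {1..4} M)"
        unfolding L_def[symmetric] by measurable
    qed (use shift in auto)
    also have "(\<Prod>j=1..4. ennreal (exp ((1 - p) * q j * \<epsilon>))) = ennreal (exp (\<Sum>j=1..4. (1 - p) * q j * \<epsilon>))"
      by (simp add: prod_ennreal exp_sum)
    also have "(\<Sum>j=1..4. (1 - p) * q j * \<epsilon>) = (1 - p) * \<epsilon>"
      using assms(5) by (simp flip: sum_distrib_left sum_distrib_right)
    finally show ?thesis .
  qed
  have dp: "measure (two_stage \<phi> \<Theta> \<alpha> \<beta> \<Delta> \<eta> \<epsilon> p q D) B
      \<le> exp \<epsilon> * measure (two_stage \<phi> \<Theta> \<alpha> \<beta> \<Delta> \<eta> \<epsilon> p q D') B"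
    if adj: "adjacent records n D D'" and B [measurable]: "B \<in> sets borel" for D D' B
  proof -
    have D: "D \<in> databases records n" "D' \<in> databases records n"
      using adj by (auto simp: adjacent_def)
    have T: "emeasure (two_stage \<phi> \<Theta> \<alpha> \<beta> \<Delta> \<eta> \<epsilon> p q E) B
        = ennreal (measure (two_stage \<phi> \<Theta> \<alpha> \<beta> \<Delta> \<eta> \<epsilon> p q E) B)" if "E \<in> {D, D'}" for E
      using that D prob by (intro finite_measure.emeasure_eq_measure prob_space.finite_measure) auto
    have Q_meas: "Q D' B \<in> borel_measurable (lebesgue_on \<Theta>)"
      using sigma_finite_measure.borel_measurable_nn_integral_fst[OF L_finite measurable_compose[OF F_meas borel_measurable_indicator[OF B]]]
      by (simp add: Q_def[abs_def])
    \<comment> \<open>The second stage is exchanged first, under the law of the draw for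
      \<open>D\<close>; then that law is exchanged while the integrand \<open>Q D' B\<close> stays
      fixed.\<close>
    have "emeasure (two_stage \<phi> \<Theta> \<alpha> \<beta> \<Delta> \<eta> \<epsilon> p q D) B
        \<le> (\<integral>\<^sup>+\<theta>. ennreal (exp ((1 - p) * \<epsilon>)) * Q D' B \<theta> \<partial>?P D)"
      unfolding emeasure_eq[OF B] using second_stage[OF adj B] by (intro nn_integral_mono) simp
    also have "\<dots> = ennreal (exp ((1 - p) * \<epsilon>)) * (\<integral>\<^sup>+\<theta>. Q D' B \<theta> \<partial>?P D)"
      using Q_meas by (intro nn_integral_cmult) (simp cong: measurable_cong_sets add: sets_proportional_to)
    \<comment> \<open>The density-ratio bound is used with
      \<open>k = exp (p * \<epsilon> / 2)\<close>, so its square spends exactly the first-stage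
      budget \<open>p * \<epsilon>\<close>.\<close>
    also have "\<dots> \<le> ennreal (exp ((1 - p) * \<epsilon>)) *
        (ennreal ((exp (p * \<epsilon> / 2))\<^sup>2) * (\<integral>\<^sup>+\<theta>. Q D' B \<theta> \<partial>?P D'))"
    proof (intro mult_left_mono nn_integral_proportional_to_le)
      show "kng_weight \<phi> \<alpha> \<beta> \<Delta> (p * \<epsilon>) D \<theta> \<le> exp (p * \<epsilon> / 2) * kng_weight \<phi> \<alpha> \<beta> \<Delta> (p * \<epsilon>) D' \<theta>"
        if "\<theta> \<in> \<Theta>" for \<theta>
        using that assms(1,2,11) assms(12)[OF that adj] by (intro kng_weight_le) auto
      show "kng_weight \<phi> \<alpha> \<beta> \<Delta> (p * \<epsilon>) D' \<theta> \<le> exp (p * \<epsilon> / 2) * kng_weight \<phi> \<alpha> \<beta> \<Delta> (p * \<epsilon>) D \<theta>"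
        if "\<theta> \<in> \<Theta>" for \<theta>
        using that assms(1,2,11) assms(12)[OF that adjacent_sym[OF adj]] by (intro kng_weight_le) auto
    qed (use D assms(14) Q_meas in \<open>auto simp: kng_weight_def\<close>)
    also have "\<dots> = ennreal (exp ((1 - p) * \<epsilon>) * (exp (p * \<epsilon> / 2))\<^sup>2)
        * emeasure (two_stage \<phi> \<Theta> \<alpha> \<beta> \<Delta> \<eta> \<epsilon> p q D') B"
      unfolding emeasure_eq[OF B] by (simp add: ennreal_mult' mult.assoc)
    also have "exp ((1 - p) * \<epsilon>) * (exp (p * \<epsilon> / 2))\<^sup>2 = exp \<epsilon>"
    proof -
      have "(exp (p * \<epsilon> / 2))\<^sup>2 = exp (p * \<epsilon>)"
        by (simp flip: exp_double)
      then show ?thesis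
        by (simp add: left_diff_distrib flip: exp_add)
    qed
    finally show ?thesis
      by (simp add: T flip: ennreal_mult')
  qed
  have "sets (two_stage \<phi> \<Theta> \<alpha> \<beta> \<Delta> \<eta> \<epsilon> p q D) = sets borel" for D
    by (simp only: two_stage_eq sets_distr)
  then show ?thesis
    unfolding differentially_private_def space_prob_algebra
    using prob dp by blast
qed

end
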